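(* Let $\kappa>0$ and let $(r,v)$ be a sufficiently regular solution, on the moving gas domain $\Omega_t=\{x\in\mathbb{R}^d: r(t,x)>0\}$, of the irrotational compressible Euler system $$D_tr+\kappa r(\nabla\cdot v)=0,\qquad D_tv+\nabla r=0,\qquad \operatorname{curl}v=0 .$$ Then there exists a potential function $\phi$ with $v=\nabla\phi$ such that $$D_t\phi=\frac{|v|^2}{2}-r,\qquad D_t^2\phi+\nabla r\cdot\nabla\phi-\kappa r\Delta\phi=0 .$$ Similarly, if $(s,w)$ is a sufficiently regular solution of the linearized system $$D_ts+w\cdot\nabla r+\kappa s(\nabla\cdot v)+\kappa r(\nabla\cdot w)=0,\qquad D_tw+(w\cdot\nabla)v+\nabla s=0,\qquad \operatorname{curl}w=0,$$ then there exists a velocity potential $\psi$ with $w=\nabla\psi$ such that $$D_t\psi=-s,\qquad D_t^2\psi-\nabla r\cdot\nabla\psi-\kappa r\Delta\psi=\kappa s(\nabla\cdot v).$$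
   Context: Here $r$ and $s$ are scalar functions, $v$ and $w$ are vector fields in $\mathbb{R}^d$, all depending on $(t,x)$ with $x\in\Omega_t$, and $D_t=\partial_t+v\cdot\nabla$ is the material derivative. It is a standing convention that irrotational fields on $\Omega_t$ are gradients, i.e. curl-free $v(t,\cdot)$ and $w(t,\cdot)$ admit potentials on $\Omega_t$ depending regularly on $t$ (automatic, for instance, when $\Omega_t$ is simply connected), and that $\Omega_t$ is connected. *)

theory Defs
  imports "HOL-Analysis.Analysis"
begin

text \<open>
  A time-dependent field is a curried function of time \<open>t\<close> and position \<open>x\<close>. The time interval
  \<open>I\<close> may be open, closed or half-open; time derivatives are taken within \<open>I\<close>, so they are
  one-sided at end points belonging to \<open>I\<close>.
\<close>

definition pd :: "'d::finite \<Rightarrow> (real^'d \<Rightarrow> 'b::real_normed_vector) \<Rightarrow> real^'d \<Rightarrow> 'b" where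
  "pd i f x = frechet_derivative f (at x) (axis i 1)"

definition grad :: "(real^'d::finite \<Rightarrow> real) \<Rightarrow> real^'d \<Rightarrow> real^'d" where
  "grad f x = (\<chi> i. pd i f x)"

definition dvg :: "(real^'d::finite \<Rightarrow> real^'d) \<Rightarrow> real^'d \<Rightarrow> real" where
  "dvg u x = (\<Sum>i\<in>UNIV. pd i (\<lambda>y. u y $ i) x)"

definition laplacian :: "(real^'d::finite \<Rightarrow> real) \<Rightarrow> real^'d \<Rightarrow> real" where
  "laplacian f x = dvg (grad f) x"

text \<open>\<open>advect a f x\<close> is \<open>(a \<cdot> \<nabla>) f\<close> at \<open>x\<close>, for scalar or vector valued \<open>f\<close>.\<close>

definition advect :: "real^'d::finite \<Rightarrow> (real^'d \<Rightarrow> 'b::real_normed_vector) \<Rightarrow> real^'d \<Rightarrow> 'b" where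
  "advect a f x = (\<Sum>i\<in>UNIV. (a $ i) *\<^sub>R pd i f x)"

definition time_deriv ::
  "real set \<Rightarrow> (real \<Rightarrow> real^'d::finite \<Rightarrow> 'b::real_normed_vector) \<Rightarrow> real \<Rightarrow> real^'d \<Rightarrow> 'b" where
  "time_deriv I f t x = vector_derivative (\<lambda>\<tau>. f \<tau> x) (at t within I)"

definition material_deriv ::
  "real set \<Rightarrow> (real \<Rightarrow> real^'d::finite \<Rightarrow> real^'d) \<Rightarrow>
   (real \<Rightarrow> real^'d \<Rightarrow> 'b::real_normed_vector) \<Rightarrow> real \<Rightarrow> real^'d \<Rightarrow> 'b" where
  "material_deriv I v f t x = time_deriv I f t x + advect (v t x) (f t) x"

definition gas_domain :: "(real \<Rightarrow> real^'d::finite \<Rightarrow> real) \<Rightarrow> real \<Rightarrow> (real^'d) set" where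
  "gas_domain r t = {x. r t x > 0}"

definition spacetime_domain ::
  "real set \<Rightarrow> (real \<Rightarrow> real^'d::finite \<Rightarrow> real) \<Rightarrow> (real \<times> (real^'d)) set" where
  "spacetime_domain I r = {(t, x). t \<in> I \<and> x \<in> gas_domain r t}"

text \<open>
  Continuous differentiability jointly in \<open>(t, x)\<close>. It is only used for sets \<open>D\<close> that are
  relatively open in \<open>I \<times> UNIV\<close> for a nondegenerate interval \<open>I\<close>, where the derivative within
  \<open>D\<close> is unique.
\<close>

definition C1_on ::
  "(real \<times> (real^'d::finite)) set \<Rightarrow> (real \<Rightarrow> real^'d \<Rightarrow> 'b::real_normed_vector) \<Rightarrow> bool" where
  "C1_on D f \<longleftrightarrow>
     (\<exists>f' :: real \<times> (real^'d) \<Rightarrow> (real \<times> (real^'d)) \<Rightarrow>\<^sub>L 'b.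
        continuous_on D f' \<and>
        (\<forall>p\<in>D. ((\<lambda>(t, x). f t x) has_derivative blinfun_apply (f' p)) (at p within D)))"

definition C2_on ::
  "real set \<Rightarrow> (real \<times> (real^'d::finite)) set \<Rightarrow> (real \<Rightarrow> real^'d \<Rightarrow> real) \<Rightarrow> bool" where
  "C2_on I D f \<longleftrightarrow> C1_on D f \<and> C1_on D (time_deriv I f) \<and> C1_on D (\<lambda>t. grad (f t))"

definition curl_free_on ::
  "(real \<times> (real^'d::finite)) set \<Rightarrow> (real \<Rightarrow> real^'d \<Rightarrow> real^'d) \<Rightarrow> bool" where
  "curl_free_on D u \<longleftrightarrow>
     (\<forall>(t, x)\<in>D. \<forall>i j. pd i (\<lambda>y. u t y $ j) x = pd j (\<lambda>y. u t y $ i) x)"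

definition potential_on ::
  "(real \<times> (real^'d::finite)) set \<Rightarrow> (real \<Rightarrow> real^'d \<Rightarrow> real) \<Rightarrow>
   (real \<Rightarrow> real^'d \<Rightarrow> real^'d) \<Rightarrow> bool" where
  "potential_on D \<phi> u \<longleftrightarrow> (\<forall>(t, x)\<in>D. u t x = grad (\<phi> t) x)"

definition irrotational_euler ::
  "real \<Rightarrow> real set \<Rightarrow> (real \<Rightarrow> real^'d::finite \<Rightarrow> real) \<Rightarrow>
   (real \<Rightarrow> real^'d \<Rightarrow> real^'d) \<Rightarrow> bool" where
  "irrotational_euler \<kappa> I r v \<longleftrightarrow>
     (\<forall>(t, x)\<in>spacetime_domain I r.
        material_deriv I v r t x + \<kappa> * r t x * dvg (v t) x = 0 \<and>
        material_deriv I v v t x + grad (r t) x = 0) \<and>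
     curl_free_on (spacetime_domain I r) v"

definition linearized_irrotational_euler ::
  "real \<Rightarrow> real set \<Rightarrow> (real \<Rightarrow> real^'d::finite \<Rightarrow> real) \<Rightarrow>
   (real \<Rightarrow> real^'d \<Rightarrow> real^'d) \<Rightarrow> (real \<Rightarrow> real^'d \<Rightarrow> real) \<Rightarrow>
   (real \<Rightarrow> real^'d \<Rightarrow> real^'d) \<Rightarrow> bool" where
  "linearized_irrotational_euler \<kappa> I r v s w \<longleftrightarrow>
     (\<forall>(t, x)\<in>spacetime_domain I r.
        material_deriv I v s t x + w t x \<bullet> grad (r t) x
          + \<kappa> * s t x * dvg (v t) x + \<kappa> * r t x * dvg (w t) x = 0 \<and>
        material_deriv I v w t x + advect (w t x) (v t) x + grad (s t) x = 0) \<and>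
     curl_free_on (spacetime_domain I r) w"

end

theory Submission imports Defs begin

text \<open>
  The idea is Bernoulli's law. For a curl-free field \<open>(v \<cdot> \<nabla>)v = \<nabla>(|v|\<^sup>2/2)\<close>, so the momentum
  equation says \<open>\<partial>\<^sub>tv = -\<nabla>g\<close> with \<open>g = |v|\<^sup>2/2 + r\<close>. Likewise
  \<open>(v \<cdot> \<nabla>)w + (w \<cdot> \<nabla>)v = \<nabla>(v \<cdot> w)\<close> for curl-free \<open>v\<close> and \<open>w\<close>
  (lemma \<open>grad_inner_product_curl_free\<close>), and the linearized momentum equation says \<open>\<partial>\<^sub>tw = -\<nabla>g\<close> with
  \<open>g = v \<cdot> w + s\<close>. Both claims thus come from one fact about a field \<open>u\<close> that has a
  potential and satisfies \<open>\<partial>\<^sub>tu = -\<nabla>g\<close>: among its potentials there is one with \<open>\<partial>\<^sub>t\<phi> = -g\<close>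
  (lemma \<open>potential_with_time_derivative\<close>). Then \<open>D\<^sub>t\<phi> = -g + v \<cdot> u\<close>, which is \<open>|v|\<^sup>2/2 - r\<close> in the
  first case and \<open>-s\<close> in the second.

  To find that potential, start from an arbitrary one, \<open>\<phi>\<^sub>0\<close>. Time derivative and gradient
  commute on \<open>\<phi>\<^sub>0\<close> although it is only known to be \<open>C\<^sup>1\<close> with \<open>C\<^sup>1\<close> gradient
  (lemma \<open>gradient_time_deriv_commute\<close>); hence \<open>\<partial>\<^sub>t\<phi>\<^sub>0 + g\<close> depends on time alone, and its
  antiderivative in time is subtracted from \<open>\<phi>\<^sub>0\<close>. The gas may be absent at some times, so the antiderivative is
  taken on a relatively open set of times that need not be an interval
  (lemma \<open>antiderivative_on_relatively_open\<close>).

  The second-order identities need no further analysis. The formula for \<open>D\<^sub>t\<phi>\<close> has a \<open>C\<^sup>1\<close> right-hand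
  side, so \<open>D\<^sub>t\<close> may be applied to it: in the first case \<open>D\<^sub>t\<^sup>2\<phi> = v \<cdot> D\<^sub>tv - D\<^sub>tr\<close>, in the second
  \<open>D\<^sub>t\<^sup>2\<psi> = -D\<^sub>ts\<close>. Substituting the evolution equations, with \<open>\<Delta>\<phi> = \<nabla> \<cdot> v\<close> and
  \<open>\<Delta>\<psi> = \<nabla> \<cdot> w\<close>, gives the wave equations.
\<close>

section \<open>Partial derivatives at a point\<close>

lemma frechet_partials:
  fixes f :: "real^'d::finite \<Rightarrow> 'b::real_normed_vector"
  assumes "(f has_derivative f') (at x)"
  shows pd_eq: "pd i f x = f' (axis i 1)"
    and advect_eq: "advect a f x = f' a"
proof -
  show pd: "pd i f x = f' (axis i 1)" for i
    using frechet_derivative_at[OF assms] by (simp add: pd_def)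
  interpret bounded_linear f' using assms by (rule has_derivative_bounded_linear)
  have "f' a = f' (\<Sum>i\<in>UNIV. (a $ i) *\<^sub>R axis i 1)"
    using basis_expansion[of a] by (simp add: scalar_mult_eq_scaleR)
  also have "\<dots> = advect a f x"
    by (simp add: advect_def pd sum scaleR)
  finally show "advect a f x = f' a" ..
qed

lemma grad_inner:
  fixes f :: "real^'d::finite \<Rightarrow> real"
  assumes "(f has_derivative f') (at x)"
  shows "grad f x \<bullet> a = f' a"
  unfolding advect_eq[OF assms, symmetric]
  by (simp add: advect_def grad_def inner_vec_def mult.commute)

lemma grad_eqI:
  fixes f :: "real^'d::finite \<Rightarrow> real"
  assumes "(f has_derivative (\<lambda>h. a \<bullet> h)) (at x)"
  shows "grad f x = a"
  using grad_inner[OF assms] vector_eq_rdot by blast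

lemma pd_component:
  fixes u :: "real^'d::finite \<Rightarrow> real^'d"
  assumes "u differentiable at x"
  shows "pd i (\<lambda>y. u y $ j) x = pd i u x $ j"
proof -
  obtain u' where u': "(u has_derivative u') (at x)"
    using assms by (auto simp: differentiable_def)
  have "((\<lambda>y. u y $ j) has_derivative (\<lambda>h. u' h $ j)) (at x)"
    by (rule bounded_linear.has_derivative[OF bounded_linear_vec_nth u'])
  from pd_eq[OF this] show ?thesis by (simp add: pd_eq[OF u'])
qed

lemma dvg_cong_open:
  fixes u w :: "real^'d::finite \<Rightarrow> real^'d"
  assumes "open S" "x \<in> S" "\<And>y. y \<in> S \<Longrightarrow> u y = w y" "w differentiable at x"
  shows "dvg u x = dvg w x"
proof -
  obtain w' where w': "(w has_derivative w') (at x)"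
    using assms by (auto simp: differentiable_def)
  have u': "(u has_derivative w') (at x)"
    using has_derivative_transform_within_open[OF w' assms(1,2)] assms(3) by simp
  have "u differentiable at x" using u' by (auto simp: differentiable_def)
  then show ?thesis
    using assms(4) by (simp add: dvg_def pd_component pd_eq[OF u'] pd_eq[OF w'])
qed

text \<open>
  The product rule gives \<open>\<nabla>(u \<cdot> w) = (\<nabla>u)\<^sup>T w + (\<nabla>w)\<^sup>T u\<close>. Vanishing curl says that both
  Jacobians are symmetric, so the transposes may be dropped, and what is left are the two
  advection terms. With \<open>u = w = v\<close> this is \<open>\<nabla>(|v|\<^sup>2/2) = (v \<cdot> \<nabla>)v\<close>, the identity that turns the
  momentum equation into a gradient.
\<close>

lemma grad_inner_product_curl_free:
  fixes u w :: "real^'d::finite \<Rightarrow> real^'d"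
  assumes u: "u differentiable at x" and w: "w differentiable at x"
    and cu: "\<And>i j. pd i (\<lambda>y. u y $ j) x = pd j (\<lambda>y. u y $ i) x"
    and cw: "\<And>i j. pd i (\<lambda>y. w y $ j) x = pd j (\<lambda>y. w y $ i) x"
  shows "grad (\<lambda>y. u y \<bullet> w y) x = advect (u x) w x + advect (w x) u x"
proof (subst vec_eq_iff, rule allI)
  fix i
  obtain u' where u': "(u has_derivative u') (at x)"
    using u by (auto simp: differentiable_def)
  obtain w' where w': "(w has_derivative w') (at x)"
    using w by (auto simp: differentiable_def)
  have "((\<lambda>y. u y \<bullet> w y) has_derivative (\<lambda>h. u x \<bullet> w' h + u' h \<bullet> w x)) (at x)"
    by (rule has_derivative_inner[OF u' w'])
  then have "grad (\<lambda>y. u y \<bullet> w y) x $ i = u x \<bullet> pd i w x + pd i u x \<bullet> w x"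
    by (simp only: grad_def vec_lambda_beta pd_eq pd_eq[OF u'] pd_eq[OF w'])
  also have "\<dots> = (\<Sum>j\<in>UNIV. u x $ j * pd j w x $ i) + (\<Sum>j\<in>UNIV. w x $ j * pd j u x $ i)"
    unfolding inner_vec_def
    using cu cw pd_component[OF u] pd_component[OF w]
    by (intro arg_cong2[where f="(+)"] sum.cong) (simp_all add: mult.commute)
  finally show "grad (\<lambda>y. u y \<bullet> w y) x $ i = (advect (u x) w x + advect (w x) u x) $ i"
    by (simp add: advect_def)
qed

section \<open>Antiderivatives on relatively open sets\<close>

text \<open>
  The set \<open>J\<close> may have infinitely many components and \<open>c\<close> may blow up at their ends, so there is no
  single base point to integrate from. One base point is chosen in each component instead; since
  every \<open>t \<in> J\<close> is interior, relative to \<open>I\<close>, to a compact interval that lies in its component and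
  contains the base point, the fundamental theorem of calculus applies near \<open>t\<close>.
\<close>

lemma antiderivative_on_relatively_open:
  fixes c :: "real \<Rightarrow> 'a::euclidean_space"
  assumes I: "is_interval I" and J: "openin (top_of_set I) J" and c: "continuous_on J c"
  obtains C where "\<And>t. t \<in> J \<Longrightarrow> (C has_vector_derivative c t) (at t within I)"
proof
  define base where "base t = (SOME a. a \<in> connected_component_set J t)" for t
  define C where "C t = (LBINT y=base t..t. c y)" for t
  fix t assume t: "t \<in> J"
  then have tI: "t \<in> I" using J openin_imp_subset by blast
  have "t \<in> connected_component_set J t" using t by simp
  then have b: "base t \<in> connected_component_set J t"
    unfolding base_def by (rule someI)
  obtain \<delta> where \<delta>: "\<delta> > 0" "ball t \<delta> \<inter> I \<subseteq> J"
    using J t unfolding openin_contains_ball by blast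
  (* l and h bracket t in J: l = t only at a left end point of I and h = t only at a right
     one, so that {l..h} is always a neighbourhood of t relative to I. *)
  obtain l where l: "l \<in> ball t \<delta> \<inter> I" "l \<le> t" "\<And>y. y \<in> I \<Longrightarrow> y < t \<Longrightarrow> l < t"
  proof (cases "\<exists>y\<in>I. y < t")
    case True
    then obtain y where y: "y \<in> I" "y < t" by blast
    define l where "l = max y (t - \<delta>/2)"
    have "y \<le> l" "l \<le> t" using y \<delta>(1) by (auto simp: l_def)
    then have "l \<in> I" using mem_is_interval_1_I[OF I, of y t l] y tI by simp
    then show ?thesis using that[of l] y \<delta>(1) by (auto simp: l_def dist_real_def)
  next
    case False
    then show ?thesis using that[of t] tI \<delta>(1) by auto
  qed
  obtain h where h: "h \<in> ball t \<delta> \<inter> I" "t \<le> h" "\<And>y. y \<in> I \<Longrightarrow> t < y \<Longrightarrow> t < h"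
  proof (cases "\<exists>y\<in>I. t < y")
    case True
    then obtain y where y: "y \<in> I" "t < y" by blast
    define h where "h = min y (t + \<delta>/2)"
    have "t \<le> h" "h \<le> y" using y \<delta>(1) by (auto simp: h_def)
    then have "h \<in> I" using mem_is_interval_1_I[OF I, of t y h] y tI by simp
    then show ?thesis using that[of h] y \<delta>(1) by (auto simp: h_def dist_real_def)
  next
    case False
    then show ?thesis using that[of t] tI \<delta>(1) by auto
  qed
  have "{l..h} \<subseteq> ball t \<delta> \<inter> I"
  proof
    fix y assume y: "y \<in> {l..h}"
    then have "y \<in> I" using mem_is_interval_1_I[OF I, of l h y] l(1) h(1) by simp
    then show "y \<in> ball t \<delta> \<inter> I" using y l(1) h(1) by (auto simp: dist_real_def)
  qed
  then have lhJ: "{l..h} \<subseteq> J" using \<delta>(2) by blast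
  have lhK: "{l..h} \<subseteq> connected_component_set J t"
    using l h lhJ by (intro connected_component_maximal) (auto simp: is_interval_connected)
  define m where "m = min (base t) l"
  define M where "M = max (base t) h"
  have K: "is_interval (connected_component_set J t)"
    by (simp add: is_interval_connected_1)
  have mM: "m \<in> connected_component_set J t" "M \<in> connected_component_set J t"
    using b lhK l(2) h(2) by (simp_all add: m_def M_def min_def max_def subset_iff)
  have sub: "{m..M} \<subseteq> connected_component_set J t"
    using mem_is_interval_1_I[OF K mM] by auto
  then have subJ: "{m..M} \<subseteq> J" using connected_component_subset by blast
  have "((\<lambda>u. LBINT y=base t..u. c y) has_vector_derivative c t) (at t within {m..M})"
    using l h by (intro interval_integral_FTC2 continuous_on_subset[OF c subJ]) (auto simp: m_def M_def)
  then have "(C has_vector_derivative c t) (at t within {m..M})"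
  proof (rule has_vector_derivative_transform[rotated 2])
    show "t \<in> {m..M}" using l h by (auto simp: m_def M_def)
    fix u assume "u \<in> {m..M}"
    then have "connected_component_set J u = connected_component_set J t"
      using sub connected_component_eq by blast
    then show "C u = (LBINT y=base t..u. c y)" by (simp add: C_def base_def)
  qed
  moreover have "at t within {m..M} = at t within I"
  proof (rule at_within_nhd)
    (* On a side where I has no points beyond t, the window is simply cut at distance 1. *)
    let ?T = "{(if l < t then l else t - 1)<..<(if t < h then h else t + 1)}"
    show "t \<in> ?T" "open ?T" using l(2) h(2) by auto
    have "{m..M} \<subseteq> I" using subJ J openin_imp_subset by blast
    moreover have "y \<in> {m..M}" if "y \<in> I" "y \<in> ?T" for y
      using that l(2) h(2) l(3)[OF that(1)] h(3)[OF that(1)]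
      by (cases y t rule: linorder_cases) (auto simp: m_def M_def)
    ultimately show "{m..M} \<inter> ?T - {t} = I \<inter> ?T - {t}" by blast
  qed
  ultimately show "(C has_vector_derivative c t) (at t within I)" by simp
qed


section \<open>Continuously differentiable fields\<close>

lemma C1_on_cong:
  assumes "\<And>t x. (t, x) \<in> D \<Longrightarrow> f t x = g t x" and "C1_on D g"
  shows "C1_on D f"
proof -
  obtain g' where g': "continuous_on D g'"
    "\<And>p. p \<in> D \<Longrightarrow> ((\<lambda>(t, x). g t x) has_derivative blinfun_apply (g' p)) (at p within D)"
    using assms(2) unfolding C1_on_def by blast
  have "((\<lambda>(t, x). f t x) has_derivative blinfun_apply (g' p)) (at p within D)" if "p \<in> D" for p
    using assms(1) by (intro has_derivative_transform[OF that _ g'(2)[OF that]]) auto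
  then show ?thesis using g'(1) unfolding C1_on_def by blast
qed

lemma C1_on_add:
  assumes "C1_on D f" and "C1_on D g"
  shows "C1_on D (\<lambda>t x. f t x + g t x)"
proof -
  obtain f' where f': "continuous_on D f'"
    "\<And>p. p \<in> D \<Longrightarrow> ((\<lambda>(t, x). f t x) has_derivative blinfun_apply (f' p)) (at p within D)"
    using assms(1) unfolding C1_on_def by blast
  obtain g' where g': "continuous_on D g'"
    "\<And>p. p \<in> D \<Longrightarrow> ((\<lambda>(t, x). g t x) has_derivative blinfun_apply (g' p)) (at p within D)"
    using assms(2) unfolding C1_on_def by blast
  show ?thesis
    unfolding C1_on_def
  proof (intro exI conjI ballI)
    show "continuous_on D (\<lambda>p. f' p + g' p)"
      by (intro continuous_intros f' g')
    fix p assume "p \<in> D"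
    from has_derivative_add[OF f'(2)[OF this] g'(2)[OF this]]
    show "((\<lambda>(t, x). f t x + g t x) has_derivative blinfun_apply (f' p + g' p)) (at p within D)"
      by (simp add: case_prod_unfold plus_blinfun.rep_eq)
  qed
qed

lemma C1_on_scaleR:
  assumes "C1_on D f"
  shows "C1_on D (\<lambda>t x. k *\<^sub>R f t x)"
proof -
  obtain f' where f': "continuous_on D f'"
    "\<And>p. p \<in> D \<Longrightarrow> ((\<lambda>(t, x). f t x) has_derivative blinfun_apply (f' p)) (at p within D)"
    using assms(1) unfolding C1_on_def by blast
  show ?thesis
    unfolding C1_on_def
  proof (intro exI conjI ballI)
    show "continuous_on D (\<lambda>p. k *\<^sub>R f' p)"
      by (intro continuous_intros f')
    fix p assume "p \<in> D"
    from has_derivative_scaleR_right[OF f'(2)[OF this], of k]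
    show "((\<lambda>(t, x). k *\<^sub>R f t x) has_derivative blinfun_apply (k *\<^sub>R f' p)) (at p within D)"
      by (simp add: case_prod_unfold scaleR_blinfun.rep_eq)
  qed
qed

lemma C1_on_inner:
  fixes u w :: "real \<Rightarrow> real^'d::finite \<Rightarrow> 'b::real_inner"
  assumes "C1_on D u" and "C1_on D w"
  shows "C1_on D (\<lambda>t x. u t x \<bullet> w t x)"
proof -
  obtain u' where u': "continuous_on D u'"
    "\<And>p. p \<in> D \<Longrightarrow> ((\<lambda>(t, x). u t x) has_derivative blinfun_apply (u' p)) (at p within D)"
    using assms(1) unfolding C1_on_def by blast
  obtain w' where w': "continuous_on D w'"
    "\<And>p. p \<in> D \<Longrightarrow> ((\<lambda>(t, x). w t x) has_derivative blinfun_apply (w' p)) (at p within D)"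
    using assms(2) unfolding C1_on_def by blast
  have cont: "continuous_on D (\<lambda>(t, x). u t x)" "continuous_on D (\<lambda>(t, x). w t x)"
    by (rule has_derivative_continuous_on[OF u'(2)], assumption)
       (rule has_derivative_continuous_on[OF w'(2)], assumption)
  let ?d = "\<lambda>p. (blinfun_inner_right (case p of (t, x) \<Rightarrow> u t x) o\<^sub>L w' p)
                + (blinfun_inner_left (case p of (t, x) \<Rightarrow> w t x) o\<^sub>L u' p)"
  show ?thesis
    unfolding C1_on_def
  proof (intro exI conjI ballI)
    show "continuous_on D ?d"
      using bounded_linear.continuous_on[OF bounded_linear_blinfun_inner_right cont(1)]
        bounded_linear.continuous_on[OF bounded_linear_blinfun_inner_left cont(2)] u'(1) w'(1)
      by (intro continuous_on_add bounded_bilinear.continuous_on[OF bounded_bilinear_blinfun_compose])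
    fix p assume "p \<in> D"
    from has_derivative_inner[OF u'(2)[OF this] w'(2)[OF this]]
    show "((\<lambda>(t, x). u t x \<bullet> w t x) has_derivative blinfun_apply (?d p)) (at p within D)"
      by (simp add: case_prod_unfold plus_blinfun.rep_eq o_def)
  qed
qed

section \<open>Differential calculus on a relatively open spacetime region\<close>

text \<open>
  The domain of a gas moving in \<open>I \<times> \<real>\<^sup>d\<close>, described without reference to the gas. Relative
  openness makes the spatial slices open and keeps each point in the region for nearby times of
  \<open>I\<close>, so that spatial derivatives and derivatives in time within \<open>I\<close> are determined by the values
  in the region; the latter are unique because \<open>I\<close> has no isolated points.
\<close>

locale spacetime_region =
  fixes I :: "real set" and D :: "(real \<times> (real^'d::finite)) set"
  assumes interval: "is_interval I" and nondegenerate: "interior I \<noteq> {}"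
    and rel_open: "openin (top_of_set (I \<times> UNIV)) D"
begin

lemma time_in_I: "(t, x) \<in> D \<Longrightarrow> t \<in> I"
  using rel_open openin_imp_subset by blast

lemma not_trivial_at:
  assumes "t \<in> I"
  shows "at t within I \<noteq> bot"
proof -
  have "I \<noteq> {y}" for y
    using nondegenerate interior_singleton by metis
  then have "t islimpt I"
    using assms interval by (intro connected_imp_perfect) (auto simp: is_interval_connected)
  then show ?thesis by (simp add: trivial_limit_within)
qed

lemma box_around:
  assumes "(t, x) \<in> D"
  obtains e where "e > 0" "\<And>\<tau> y. \<tau> \<in> I \<Longrightarrow> dist \<tau> t < e \<Longrightarrow> dist y x < e \<Longrightarrow> (\<tau>, y) \<in> D"
proof -
  obtain T where T: "open T" "D = (I \<times> UNIV) \<inter> T"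
    using rel_open by (auto simp: openin_open)
  then obtain A B where AB: "open A" "open B" "t \<in> A" "x \<in> B" "A \<times> B \<subseteq> T"
    using assms by (metis IntD2 SigmaE2 open_prod_elim)
  obtain a where a: "a > 0" "ball t a \<subseteq> A" using AB openE by blast
  obtain b where b: "b > 0" "ball x b \<subseteq> B" using AB openE by blast
  show ?thesis
  proof (rule that[of "min a b"])
    show "min a b > 0" using a b by simp
    fix \<tau> y assume *: "\<tau> \<in> I" "dist \<tau> t < min a b" "dist y x < min a b"
    then have "\<tau> \<in> A" "y \<in> B" using a b by (auto simp: dist_commute)
    then show "(\<tau>, y) \<in> D" using T AB * by auto
  qed
qed

lemma open_slice: "open {x. (t, x) \<in> D}"
proof (rule openI)
  fix x assume "x \<in> {x. (t, x) \<in> D}"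
  then have tx: "(t, x) \<in> D" by simp
  obtain e where "e > 0" "\<And>\<tau> y. \<tau> \<in> I \<Longrightarrow> dist \<tau> t < e \<Longrightarrow> dist y x < e \<Longrightarrow> (\<tau>, y) \<in> D"
    using box_around[OF tx] by blast
  then show "\<exists>e>0. ball x e \<subseteq> {x. (t, x) \<in> D}"
    using time_in_I[OF tx] by (auto simp: dist_commute)
qed

lemma at_within_section:
  assumes "(t, x) \<in> D"
  shows "at t within {\<tau>. (\<tau>, x) \<in> D} = at t within I"
proof -
  obtain e where e: "e > 0" "\<And>\<tau> y. \<tau> \<in> I \<Longrightarrow> dist \<tau> t < e \<Longrightarrow> dist y x < e \<Longrightarrow> (\<tau>, y) \<in> D"
    using box_around[OF assms] by blast
  then have "{\<tau>. (\<tau>, x) \<in> D} \<inter> ball t e - {t} = I \<inter> ball t e - {t}"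
    by (auto simp: dist_commute time_in_I)
  then show ?thesis by (intro at_within_nhd[of _ "ball t e"]) (use e in auto)
qed

text \<open>
  Every derivative occurring in the equations is the joint derivative at \<open>(t, x)\<close> in some direction.
  In particular \<open>D\<^sub>t\<close> is the derivative along \<open>(1, v)\<close>, so that locality of \<open>D\<^sub>t\<close> and its linearity and
  product rule are those of the joint derivative.
\<close>

lemma joint_derivative:
  assumes f: "((\<lambda>(t, x). f t x) has_derivative f') (at (t, x) within D)" and tx: "(t, x) \<in> D"
  shows space_derivative: "(f t has_derivative (\<lambda>h. f' (0, h))) (at x)"
    and time_derivative: "((\<lambda>\<tau>. f \<tau> x) has_vector_derivative f' (1, 0)) (at t within I)"
    and time_deriv_eq: "time_deriv I f t x = f' (1, 0)"
    and material_deriv_eq: "material_deriv I v f t x = f' (1, v t x)"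
proof -
  interpret bounded_linear f' using f by (rule has_derivative_bounded_linear)
  let ?S = "{y. (t, y) \<in> D}" and ?T = "{\<tau>. (\<tau>, x) \<in> D}"
  have "((\<lambda>y. case (t, y) of (t, x) \<Rightarrow> f t x) has_derivative (\<lambda>h. f' (0, h))) (at x within ?S)"
    by (rule has_derivative_in_compose[where f = "Pair t", OF _ has_derivative_subset[OF f]])
       (auto intro!: derivative_eq_intros)
  then show space: "(f t has_derivative (\<lambda>h. f' (0, h))) (at x)"
    using at_within_open[OF _ open_slice, of x t] tx by simp
  have "((\<lambda>\<tau>. case (\<tau>, x) of (t, x) \<Rightarrow> f t x) has_derivative (\<lambda>h. f' (h, 0))) (at t within ?T)"
    by (rule has_derivative_in_compose[where f = "\<lambda>\<tau>. (\<tau>, x)", OF _ has_derivative_subset[OF f]])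
       (auto intro!: derivative_eq_intros)
  moreover have "(\<lambda>h. f' (h, 0)) = (\<lambda>h. h *\<^sub>R f' (1, 0))"
    using scaleR[of _ "(1, 0)"] by (intro ext) (metis mult.right_neutral real_scaleR_def scaleR_Pair scaleR_zero_right)
  ultimately show time: "((\<lambda>\<tau>. f \<tau> x) has_vector_derivative f' (1, 0)) (at t within I)"
    unfolding has_vector_derivative_def at_within_section[OF tx] by (simp only: case_prod_conv)
  show td: "time_deriv I f t x = f' (1, 0)"
    unfolding time_deriv_def
    by (rule vector_derivative_within[OF not_trivial_at[OF time_in_I[OF tx]] time])
  show "material_deriv I v f t x = f' (1, v t x)"
    unfolding material_deriv_def td advect_eq[OF space] using add[of "(1, 0)" "(0, v t x)"] by simp
qed

lemma C1_on_joint_derivative: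
  assumes "C1_on D f" and "(t, x) \<in> D"
  obtains f' where "((\<lambda>(t, x). f t x) has_derivative f') (at (t, x) within D)"
  using assms unfolding C1_on_def by blast

lemma C1_on_differentiable:
  assumes "C1_on D f" and "(t, x) \<in> D"
  shows "f t differentiable at x"
  using C1_on_joint_derivative[OF assms] space_derivative[OF _ assms(2)]
  unfolding differentiable_def by blast

lemma C1_on_grad:
  fixes f :: "real \<Rightarrow> real^'d \<Rightarrow> real"
  assumes "C1_on D f" and "(t, x) \<in> D"
  shows "(f t has_derivative (\<lambda>h. grad (f t) x \<bullet> h)) (at x)"
proof -
  obtain f' where f': "(f t has_derivative f') (at x)"
    using C1_on_differentiable[OF assms] unfolding differentiable_def by blast
  then show ?thesis by (simp only: grad_inner[OF f'])
qed

lemma C1_on_time_derivative: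
  assumes "C1_on D f" and "(t, x) \<in> D"
  shows "((\<lambda>\<tau>. f \<tau> x) has_vector_derivative time_deriv I f t x) (at t within I)"
proof -
  obtain f' where f': "((\<lambda>(t, x). f t x) has_derivative f') (at (t, x) within D)"
    using C1_on_joint_derivative[OF assms] by blast
  show ?thesis
    using time_derivative[OF f' assms(2)] unfolding time_deriv_eq[OF f' assms(2)] .
qed

lemma C1_on_continuous_time_deriv:
  assumes "C1_on D f"
  shows "continuous_on D (\<lambda>(t, x). time_deriv I f t x)"
proof -
  obtain f' where f': "continuous_on D f'"
    "\<And>p. p \<in> D \<Longrightarrow> ((\<lambda>(t, x). f t x) has_derivative blinfun_apply (f' p)) (at p within D)"
    using assms unfolding C1_on_def by blast
  have "continuous_on D (\<lambda>p. f' p (1, 0))"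
    by (intro continuous_intros f')
  moreover have "(case p of (t, x) \<Rightarrow> time_deriv I f t x) = f' p (1, 0)" if "p \<in> D" for p
    using time_deriv_eq f'(2)[OF that] that by (cases p) auto
  ultimately show ?thesis by (simp cong: continuous_on_cong)
qed

lemma material_deriv_cong:
  assumes "C1_on D g" and "\<And>t x. (t, x) \<in> D \<Longrightarrow> f t x = g t x" and tx: "(t, x) \<in> D"
  shows "material_deriv I v f t x = material_deriv I v g t x"
proof -
  obtain g' where g': "((\<lambda>(t, x). g t x) has_derivative g') (at (t, x) within D)"
    using C1_on_joint_derivative[OF assms(1) tx] by blast
  have f': "((\<lambda>(t, x). f t x) has_derivative g') (at (t, x) within D)"
    by (rule has_derivative_transform[OF tx _ g']) (use assms(2) in auto)
  show ?thesis by (simp only: material_deriv_eq[OF f' tx] material_deriv_eq[OF g' tx])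
qed

lemma material_deriv_add:
  assumes "C1_on D f" "C1_on D g" and tx: "(t, x) \<in> D"
  shows "material_deriv I v (\<lambda>t x. f t x + g t x) t x = material_deriv I v f t x + material_deriv I v g t x"
proof -
  obtain f' where f': "((\<lambda>(t, x). f t x) has_derivative f') (at (t, x) within D)"
    using C1_on_joint_derivative[OF assms(1) tx] by blast
  obtain g' where g': "((\<lambda>(t, x). g t x) has_derivative g') (at (t, x) within D)"
    using C1_on_joint_derivative[OF assms(2) tx] by blast
  have "((\<lambda>(t, x). f t x + g t x) has_derivative (\<lambda>h. f' h + g' h)) (at (t, x) within D)"
    using has_derivative_add[OF f' g'] by (simp add: case_prod_unfold)
  from material_deriv_eq[OF this tx] show ?thesis
    by (simp add: material_deriv_eq[OF f' tx] material_deriv_eq[OF g' tx])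
qed

lemma material_deriv_scaleR:
  assumes "C1_on D f" and tx: "(t, x) \<in> D"
  shows "material_deriv I v (\<lambda>t x. k *\<^sub>R f t x) t x = k *\<^sub>R material_deriv I v f t x"
proof -
  obtain f' where f': "((\<lambda>(t, x). f t x) has_derivative f') (at (t, x) within D)"
    using C1_on_joint_derivative[OF assms(1) tx] by blast
  have "((\<lambda>(t, x). k *\<^sub>R f t x) has_derivative (\<lambda>h. k *\<^sub>R f' h)) (at (t, x) within D)"
    using has_derivative_scaleR_right[OF f'] by (simp add: case_prod_unfold)
  from material_deriv_eq[OF this tx] show ?thesis
    by (simp add: material_deriv_eq[OF f' tx])
qed

lemma material_deriv_inner:
  fixes u w :: "real \<Rightarrow> real^'d \<Rightarrow> 'b::real_inner"
  assumes "C1_on D u" "C1_on D w" and tx: "(t, x) \<in> D"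
  shows "material_deriv I v (\<lambda>t x. u t x \<bullet> w t x) t x
       = material_deriv I v u t x \<bullet> w t x + u t x \<bullet> material_deriv I v w t x"
proof -
  obtain u' where u': "((\<lambda>(t, x). u t x) has_derivative u') (at (t, x) within D)"
    using C1_on_joint_derivative[OF assms(1) tx] by blast
  obtain w' where w': "((\<lambda>(t, x). w t x) has_derivative w') (at (t, x) within D)"
    using C1_on_joint_derivative[OF assms(2) tx] by blast
  have "((\<lambda>(t, x). u t x \<bullet> w t x) has_derivative (\<lambda>h. u t x \<bullet> w' h + u' h \<bullet> w t x)) (at (t, x) within D)"
    using has_derivative_inner[OF u' w'] by (simp add: case_prod_unfold)
  from material_deriv_eq[OF this tx] show ?thesis
    by (simp add: material_deriv_eq[OF u' tx] material_deriv_eq[OF w' tx])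
qed

section \<open>Potentials with a prescribed time derivative\<close>

text \<open>
  A Schwarz theorem with minimal regularity: \<open>\<phi>\<close> is only \<open>C\<^sup>1\<close> with a \<open>C\<^sup>1\<close> gradient \<open>u\<close>, and the existence of
  \<open>\<nabla>\<partial>\<^sub>t\<phi>\<close> is part of the claim. Near \<open>(t, x)\<close> the vector \<open>\<partial>\<^sub>tu\<close> is \<open>\<epsilon>\<close>-close to \<open>a = \<partial>\<^sub>tu(t, x)\<close>. The
  mean value theorem in time, applied to \<open>u\<close>, and then in space, applied to
  \<open>\<phi>(\<tau>, \<cdot>) - \<phi>(t, \<cdot>)\<close>, shows that the mixed difference quotient of \<open>\<phi>\<close> differs from
  \<open>a \<bullet> (y - x)\<close> by at most \<open>\<epsilon> |y - x|\<close>. This bound is uniform in \<open>\<tau>\<close>, so it survives \<open>\<tau> \<rightarrow> t\<close> and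
  becomes the definition of differentiability of \<open>\<partial>\<^sub>t\<phi>(t, \<cdot>)\<close> at \<open>x\<close>.
\<close>

lemma gradient_time_deriv_commute:
  assumes \<phi>: "C1_on D \<phi>" and u: "C1_on D u" and pot: "potential_on D \<phi> u" and tx: "(t, x) \<in> D"
  shows "(time_deriv I \<phi> t has_derivative (\<lambda>h. time_deriv I u t x \<bullet> h)) (at x)"
  unfolding has_derivative_at_alt
proof (intro conjI allI impI)
  define a where "a = time_deriv I u t x"
  show "bounded_linear ((\<bullet>) (time_deriv I u t x))" by (rule bounded_linear_inner_right)
  fix \<epsilon> :: real assume \<epsilon>: "\<epsilon> > 0"
  obtain e where e: "e > 0" "\<And>\<tau> y. \<tau> \<in> I \<Longrightarrow> dist \<tau> t < e \<Longrightarrow> dist y x < e \<Longrightarrow> (\<tau>, y) \<in> D"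
    using box_around[OF tx] by blast
  obtain d1 where d1: "d1 > 0"
    "\<forall>p\<in>D. dist p (t, x) < d1 \<longrightarrow> dist (case p of (t, x) \<Rightarrow> time_deriv I u t x) a < \<epsilon>"
    using C1_on_continuous_time_deriv[OF u, unfolded continuous_on_iff, rule_format, OF tx \<epsilon>]
    unfolding a_def prod.case by blast
  define d where "d = min e (d1 / 2)"
  have d: "d > 0" using e d1 by (simp add: d_def)
  have inD: "(\<tau>, y) \<in> D" if "\<tau> \<in> I" "dist \<tau> t < d" "dist y x < d" for \<tau> y
    using that e by (simp add: d_def)
  have near: "norm (time_deriv I u \<tau> y - a) \<le> \<epsilon>" if "\<tau> \<in> I" "dist \<tau> t < d" "dist y x < d" for \<tau> y
  proof -
    have "dist (\<tau>, y) (t, x) \<le> dist \<tau> t + dist y x"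
      unfolding dist_prod_def using sqrt_sum_squares_le_sum[of "dist \<tau> t" "dist y x"] by simp
    also have "\<dots> < d1" using that unfolding d_def by linarith
    finally show ?thesis using bspec[OF d1(2) inD[OF that]] by (simp add: dist_norm)
  qed
  have increment: "norm (u \<tau> y - u t y - (\<tau> - t) *\<^sub>R a) \<le> \<epsilon> * \<bar>\<tau> - t\<bar>"
    if \<tau>: "\<tau> \<in> I" "dist \<tau> t < d" and y: "dist y x < d" for \<tau> y
  proof -
    let ?S = "closed_segment t \<tau>" and ?g = "\<lambda>\<sigma>. u \<sigma> y - \<sigma> *\<^sub>R a"
    have S: "\<sigma> \<in> I" "dist \<sigma> t < d" if "\<sigma> \<in> ?S" for \<sigma>
    proof -
      have "convex (I \<inter> ball t d)"
        using interval by (intro convex_Int is_interval_convex convex_ball)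
      moreover have "t \<in> I \<inter> ball t d" "\<tau> \<in> I \<inter> ball t d"
        using \<tau> d time_in_I[OF tx] by (simp_all add: dist_commute)
      ultimately have "?S \<subseteq> I \<inter> ball t d"
        by (intro closed_segment_subset)
      then show "\<sigma> \<in> I" "dist \<sigma> t < d" using that by (auto simp: dist_commute)
    qed
    have "norm (?g \<tau> - ?g t) \<le> \<epsilon> * norm (\<tau> - t)"
    proof (rule differentiable_bound)
      fix \<sigma> assume \<sigma>: "\<sigma> \<in> ?S"
      have "((\<lambda>\<sigma>. u \<sigma> y) has_vector_derivative time_deriv I u \<sigma> y) (at \<sigma> within ?S)"
        by (rule has_vector_derivative_within_subset[OF C1_on_time_derivative[OF u inD[OF S[OF \<sigma>] y]]])
           (use S(1) in blast)
      then show "(?g has_derivative (\<lambda>h. h *\<^sub>R (time_deriv I u \<sigma> y - a))) (at \<sigma> within ?S)"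
        unfolding has_vector_derivative_def scaleR_diff_right
        by (intro derivative_intros)
      show "onorm (\<lambda>h. h *\<^sub>R (time_deriv I u \<sigma> y - a)) \<le> \<epsilon>"
        using near[OF S[OF \<sigma>] y] \<epsilon>
        by (intro onorm_bound) (auto simp: mult.commute[of \<epsilon>] intro: mult_left_mono)
    qed auto
    then show ?thesis by (simp add: algebra_simps)
  qed
  have mixed: "\<bar>(\<phi> \<tau> y - \<phi> \<tau> x) - (\<phi> t y - \<phi> t x) - (\<tau> - t) * (a \<bullet> (y - x))\<bar> \<le> \<epsilon> * \<bar>\<tau> - t\<bar> * norm (y - x)"
    if \<tau>: "\<tau> \<in> I" "dist \<tau> t < d" and y: "dist y x < d" for \<tau> y
  proof -
    let ?k = "\<lambda>y. \<phi> \<tau> y - \<phi> t y - (\<tau> - t) * (a \<bullet> y)"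
    have "norm (?k y - ?k x) \<le> (\<epsilon> * \<bar>\<tau> - t\<bar>) * norm (y - x)"
    proof (rule differentiable_bound[of "ball x d"])
      fix z assume "z \<in> ball x d"
      then have z: "dist z x < d" by (simp add: dist_commute)
      have \<tau>z: "(\<tau>, z) \<in> D" using inD \<tau> z by blast
      have tz: "(t, z) \<in> D" using inD[of t z] time_in_I[OF tx] z d by simp
      have grads: "grad (\<phi> \<tau>) z = u \<tau> z" "grad (\<phi> t) z = u t z"
        using pot \<tau>z tz by (auto simp: potential_on_def)
      have "(?k has_derivative (\<lambda>h. u \<tau> z \<bullet> h - u t z \<bullet> h - (\<tau> - t) * (a \<bullet> h))) (at z)"
        by (intro derivative_intros C1_on_grad[OF \<phi> \<tau>z, unfolded grads] C1_on_grad[OF \<phi> tz, unfolded grads])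
      then show "(?k has_derivative (\<lambda>h. (u \<tau> z - u t z - (\<tau> - t) *\<^sub>R a) \<bullet> h)) (at z within ball x d)"
        by (simp add: inner_diff_left has_derivative_at_withinI)
      show "onorm ((\<bullet>) (u \<tau> z - u t z - (\<tau> - t) *\<^sub>R a)) \<le> \<epsilon> * \<bar>\<tau> - t\<bar>"
      proof (rule onorm_bound)
        show "0 \<le> \<epsilon> * \<bar>\<tau> - t\<bar>" using \<epsilon> by simp
        show "norm ((u \<tau> z - u t z - (\<tau> - t) *\<^sub>R a) \<bullet> h) \<le> \<epsilon> * \<bar>\<tau> - t\<bar> * norm h" for h
          unfolding real_norm_def
          by (rule order_trans[OF Cauchy_Schwarz_ineq2 mult_right_mono[OF increment[OF \<tau> z] norm_ge_zero]])
      qed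
    qed (use y d in \<open>auto simp: dist_commute\<close>)
    then show ?thesis by (simp add: algebra_simps inner_diff_right)
  qed
  show "\<exists>d>0. \<forall>y. norm (y - x) < d \<longrightarrow>
          norm (time_deriv I \<phi> t y - time_deriv I \<phi> t x - time_deriv I u t x \<bullet> (y - x)) \<le> \<epsilon> * norm (y - x)"
  proof (intro exI conjI allI impI)
    show "d > 0" by (rule d)
    fix y assume "norm (y - x) < d"
    then have y: "dist y x < d" by (simp add: dist_norm)
    have ty: "(t, y) \<in> D" using inD[of t y] time_in_I[OF tx] y d by simp
    let ?q = "\<lambda>\<tau>. \<phi> \<tau> y - \<phi> \<tau> x - \<tau> * (a \<bullet> (y - x))"
    have "(?q has_vector_derivative time_deriv I \<phi> t y - time_deriv I \<phi> t x - a \<bullet> (y - x)) (at t within I)"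
      by (intro has_vector_derivative_diff C1_on_time_derivative[OF \<phi>] ty tx)
         (auto intro!: derivative_eq_intros)
    then have "((\<lambda>\<tau>. (?q \<tau> - ?q t) / (\<tau> - t)) \<longlongrightarrow> time_deriv I \<phi> t y - time_deriv I \<phi> t x - a \<bullet> (y - x)) (at t within I)"
      by (simp add: has_real_derivative_iff_has_vector_derivative[symmetric] has_field_derivative_iff)
    then have "norm (time_deriv I \<phi> t y - time_deriv I \<phi> t x - a \<bullet> (y - x)) \<le> \<epsilon> * norm (y - x)"
    proof (rule Lim_norm_ubound[OF not_trivial_at[OF time_in_I[OF tx]]])
      show "\<forall>\<^sub>F \<tau> in at t within I. norm ((?q \<tau> - ?q t) / (\<tau> - t)) \<le> \<epsilon> * norm (y - x)"
        unfolding eventually_at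
      proof (intro exI conjI ballI impI)
        show "d > 0" by (rule d)
        fix \<tau> assume \<tau>: "\<tau> \<in> I" "\<tau> \<noteq> t \<and> dist \<tau> t < d"
        have "?q \<tau> - ?q t = (\<phi> \<tau> y - \<phi> \<tau> x) - (\<phi> t y - \<phi> t x) - (\<tau> - t) * (a \<bullet> (y - x))"
          by (simp add: algebra_simps)
        then have "\<bar>?q \<tau> - ?q t\<bar> \<le> (\<epsilon> * norm (y - x)) * \<bar>\<tau> - t\<bar>"
          using mixed[OF \<tau>(1) _ y] \<tau>(2) by (simp add: mult_ac)
        then show "norm ((?q \<tau> - ?q t) / (\<tau> - t)) \<le> \<epsilon> * norm (y - x)"
          using \<tau>(2) by (simp add: pos_divide_le_eq)
      qed
    qed
    then show "norm (time_deriv I \<phi> t y - time_deriv I \<phi> t x - time_deriv I u t x \<bullet> (y - x)) \<le> \<epsilon> * norm (y - x)"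
      by (simp add: a_def)
  qed
qed


text \<open>
  If \<open>\<partial>\<^sub>tu = -\<nabla>g\<close>, then \<open>\<partial>\<^sub>t\<phi>\<^sub>0 + g\<close> has zero gradient for any potential \<open>\<phi>\<^sub>0\<close> of \<open>u\<close>, so on the connected
  slice at time \<open>t\<close> it is a constant \<open>c(t)\<close>. Subtracting an antiderivative of \<open>c\<close> does not change the
  gradient and corrects the time derivative to \<open>-g\<close>. The result is \<open>C\<^sup>2\<close> because its
  first derivatives \<open>-g\<close> and \<open>u\<close> are \<open>C\<^sup>1\<close>.
\<close>

lemma potential_with_time_derivative:
  assumes conn: "\<And>t. t \<in> I \<Longrightarrow> connected {x. (t, x) \<in> D}"
    and \<phi>0: "C1_on D \<phi>0" and u: "C1_on D u" and g: "C1_on D g"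
    and pot: "potential_on D \<phi>0 u"
    and eq: "\<And>t x. (t, x) \<in> D \<Longrightarrow> time_deriv I u t x = - grad (g t) x"
  obtains \<phi> where "C2_on I D \<phi>" and "potential_on D \<phi> u"
    and "\<And>t x. (t, x) \<in> D \<Longrightarrow> time_deriv I \<phi> t x = - g t x"
proof -
  define F where "F t x = time_deriv I \<phi>0 t x + g t x" for t x
  have F0: "(F t has_derivative (\<lambda>h. 0)) (at x)" if tx: "(t, x) \<in> D" for t x
    using has_derivative_add[OF gradient_time_deriv_commute[OF \<phi>0 u pot tx] C1_on_grad[OF g tx]]
    by (simp add: F_def[abs_def] eq[OF tx])
  define c where "c t = F t (SOME x. (t, x) \<in> D)" for t
  have F_eq: "F t x = c t" if tx: "(t, x) \<in> D" for t x
    unfolding c_def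
  proof (rule has_derivative_zero_unique_connected[OF open_slice conn[OF time_in_I[OF tx]]])
    show "(F t has_derivative (\<lambda>h. 0)) (at y)" if "y \<in> {x. (t, x) \<in> D}" for y
      using F0 that by blast
    show "x \<in> {x. (t, x) \<in> D}" "(SOME x. (t, x) \<in> D) \<in> {x. (t, x) \<in> D}"
      using tx someI[of "\<lambda>x. (t, x) \<in> D" x] by auto
  qed
  (* The times at which the slice is nonempty: only there is c determined by F. *)
  define J where "J = fst ` D"
  have J: "openin (top_of_set I) J"
    unfolding openin_contains_ball
  proof (intro conjI ballI)
    show "J \<subseteq> I" using time_in_I by (auto simp: J_def)
    fix t assume "t \<in> J"
    then obtain x where tx: "(t, x) \<in> D" by (auto simp: J_def)
    obtain e where e: "e > 0" "\<And>\<tau> y. \<tau> \<in> I \<Longrightarrow> dist \<tau> t < e \<Longrightarrow> dist y x < e \<Longrightarrow> (\<tau>, y) \<in> D"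
      using box_around[OF tx] by blast
    have "ball t e \<inter> I \<subseteq> J"
    proof
      fix \<tau> assume "\<tau> \<in> ball t e \<inter> I"
      then have "(\<tau>, x) \<in> D" using e by (simp add: dist_commute)
      then show "\<tau> \<in> J" unfolding J_def by force
    qed
    then show "\<exists>e>0. ball t e \<inter> I \<subseteq> J" using e(1) by blast
  qed
  have contF: "continuous_on D (\<lambda>(t, x). F t x)"
  proof -
    have "continuous_on D (\<lambda>(t, x). g t x)"
      using g unfolding C1_on_def by (auto intro: has_derivative_continuous_on)
    from continuous_on_add[OF C1_on_continuous_time_deriv[OF \<phi>0] this]
    show ?thesis by (simp add: F_def case_prod_unfold)
  qed
  have contc: "continuous_on J c"
    unfolding continuous_on_eq_continuous_within
  proof
    fix t assume "t \<in> J"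
    then obtain x where tx: "(t, x) \<in> D" by (auto simp: J_def)
    let ?T = "{\<tau>. (\<tau>, x) \<in> D}"
    have "continuous_on ?T (\<lambda>\<tau>. case (\<tau>, x) of (t, x) \<Rightarrow> F t x)"
      by (rule continuous_on_compose2[OF contF, of ?T "\<lambda>\<tau>. (\<tau>, x)"]) (auto intro!: continuous_intros)
    then have "continuous_on ?T c"
      by (rule continuous_on_eq) (auto simp: F_eq)
    then have "continuous (at t within I) c"
      using tx unfolding continuous_on_eq_continuous_within at_within_section[OF tx, symmetric]
      by blast
    then show "continuous (at t within J) c"
      using openin_imp_subset[OF J] by (rule continuous_within_subset)
  qed
  obtain C where C: "\<And>t. t \<in> J \<Longrightarrow> (C has_vector_derivative c t) (at t within I)"
    using antiderivative_on_relatively_open[OF interval J contc] by blast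
  define \<phi> where "\<phi> t x = \<phi>0 t x - C t" for t x
  have C1: "C1_on D \<phi>"
  proof -
    obtain \<phi>' where \<phi>': "continuous_on D \<phi>'"
      "\<And>p. p \<in> D \<Longrightarrow> ((\<lambda>(t, x). \<phi>0 t x) has_derivative blinfun_apply (\<phi>' p)) (at p within D)"
      using \<phi>0 unfolding C1_on_def by blast
    have cfst: "continuous_on D (\<lambda>p. c (fst p))"
      by (rule continuous_on_compose2[OF contc]) (auto simp: J_def intro!: continuous_intros)
    show ?thesis
      unfolding C1_on_def
    proof (intro exI conjI ballI)
      show "continuous_on D (\<lambda>p. \<phi>' p - c (fst p) *\<^sub>R fst_blinfun)"
        by (intro continuous_on_diff continuous_on_scaleR cfst \<phi>' continuous_on_const)
      fix p assume p: "p \<in> D"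
      have "(C has_derivative (\<lambda>h. h *\<^sub>R c (fst p))) (at (fst p) within fst ` D)"
        using C[of "fst p"] p openin_imp_subset[OF J] unfolding has_vector_derivative_def J_def
        by (auto intro: has_derivative_subset)
      then have "((\<lambda>p. C (fst p)) has_derivative (\<lambda>h. fst h *\<^sub>R c (fst p))) (at p within D)"
        by (rule has_derivative_in_compose[where f = fst, rotated]) (intro derivative_intros)
      from has_derivative_diff[OF \<phi>'(2)[OF p] this]
      show "((\<lambda>(t, x). \<phi> t x) has_derivative blinfun_apply (\<phi>' p - c (fst p) *\<^sub>R fst_blinfun)) (at p within D)"
        by (simp add: \<phi>_def case_prod_unfold minus_blinfun.rep_eq scaleR_blinfun.rep_eq mult.commute)
    qed
  qed
  have grad_\<phi>: "grad (\<phi> t) x = u t x" if tx: "(t, x) \<in> D" for t x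
  proof -
    have "grad (\<phi>0 t) x = u t x" using pot tx by (auto simp: potential_on_def)
    then have "(\<phi> t has_derivative (\<lambda>h. u t x \<bullet> h)) (at x)"
      using has_derivative_diff[OF C1_on_grad[OF \<phi>0 tx] has_derivative_const[of "C t"]]
      unfolding \<phi>_def by simp
    then show ?thesis by (rule grad_eqI)
  qed
  have time_\<phi>: "time_deriv I \<phi> t x = - g t x" if tx: "(t, x) \<in> D" for t x
  proof -
    have "t \<in> J" using tx unfolding J_def by force
    from has_vector_derivative_diff[OF C1_on_time_derivative[OF \<phi>0 tx] C[OF this]]
    have "time_deriv I \<phi> t x = time_deriv I \<phi>0 t x - c t"
      unfolding time_deriv_def \<phi>_def
      by (rule vector_derivative_within[OF not_trivial_at[OF time_in_I[OF tx]]])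
    then show ?thesis using F_eq[OF tx] by (simp add: F_def)
  qed
  have "C1_on D (time_deriv I \<phi>)"
    by (rule C1_on_cong[OF _ C1_on_scaleR[OF g, of "-1"]]) (simp add: time_\<phi>)
  moreover have "C1_on D (\<lambda>t. grad (\<phi> t))"
    by (rule C1_on_cong[OF _ u]) (rule grad_\<phi>)
  ultimately have "C2_on I D \<phi>" using C1 by (simp add: C2_on_def)
  moreover have "potential_on D \<phi> u"
    using grad_\<phi> by (auto simp: potential_on_def)
  ultimately show ?thesis using time_\<phi> by (rule that)
qed

section \<open>First and second material derivatives of a potential\<close>

lemma material_deriv_potential:
  assumes "C1_on D \<phi>" and "potential_on D \<phi> u" and tx: "(t, x) \<in> D"
  shows "material_deriv I v \<phi> t x = time_deriv I \<phi> t x + v t x \<bullet> u t x"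
proof -
  have "grad (\<phi> t) x = u t x" using assms(2) tx by (auto simp: potential_on_def)
  then show ?thesis
    using advect_eq[OF C1_on_grad[OF assms(1) tx]] by (simp add: material_deriv_def inner_commute)
qed

lemma laplacian_potential:
  assumes "potential_on D \<phi> u" and "C1_on D u" and tx: "(t, x) \<in> D"
  shows "laplacian (\<phi> t) x = dvg (u t) x"
  unfolding laplacian_def
proof (rule dvg_cong_open[OF open_slice _ _ C1_on_differentiable[OF assms(2) tx]])
  show "x \<in> {x. (t, x) \<in> D}" using tx by simp
  show "grad (\<phi> t) y = u t y" if "y \<in> {x. (t, x) \<in> D}" for y
    using assms(1) that by (auto simp: potential_on_def)
qed

lemma grad_inner_product:
  assumes "C1_on D u" "C1_on D w" "curl_free_on D u" "curl_free_on D w" and tx: "(t, x) \<in> D"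
  shows "grad (\<lambda>y. u t y \<bullet> w t y) x = advect (u t x) (w t) x + advect (w t x) (u t) x"
  using assms
  by (intro grad_inner_product_curl_free C1_on_differentiable[OF _ tx])
     (auto simp: curl_free_on_def)

lemma grad_add_scaleR:
  assumes "C1_on D f" "C1_on D g" and tx: "(t, x) \<in> D"
  shows "grad (\<lambda>y. k *\<^sub>R f t y + g t y) x = k *\<^sub>R grad (f t) x + grad (g t) x"
proof (rule grad_eqI)
  show "((\<lambda>y. k *\<^sub>R f t y + g t y) has_derivative
      (\<lambda>h. (k *\<^sub>R grad (f t) x + grad (g t) x) \<bullet> h)) (at x)"
    using has_derivative_add[OF has_derivative_scaleR_right[OF C1_on_grad[OF assms(1) tx], of k]
      C1_on_grad[OF assms(2) tx]]
    unfolding inner_add_left inner_scaleR_left real_scaleR_def by simp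
qed

end

section \<open>Velocity potentials for the Euler and the linearized Euler system\<close>

theorem proposition2p1:
  fixes \<kappa> :: real
    and I :: "real set"
    and r :: "real \<Rightarrow> real^'d::finite \<Rightarrow> real"
    and v :: "real \<Rightarrow> real^'d \<Rightarrow> real^'d"
  defines "D \<equiv> spacetime_domain I r"
  assumes "\<kappa> > 0"
    and "is_interval I" and "interior I \<noteq> {}"
    and "openin (top_of_set (I \<times> UNIV)) D"
    and "\<forall>t\<in>I. connected (gas_domain r t)"
    and "C1_on D r" and "C1_on D v"
    and "irrotational_euler \<kappa> I r v"
    and "curl_free_on D v \<longrightarrow> (\<exists>\<phi>. C1_on D \<phi> \<and> potential_on D \<phi> v)"
  shows
    "(\<exists>\<phi>. C2_on I D \<phi> \<and> potential_on D \<phi> v \<and>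
        (\<forall>(t, x)\<in>D.
           material_deriv I v \<phi> t x = (norm (v t x))\<^sup>2 / 2 - r t x \<and>
           material_deriv I v (material_deriv I v \<phi>) t x
             + grad (r t) x \<bullet> grad (\<phi> t) x - \<kappa> * r t x * laplacian (\<phi> t) x = 0)) \<and>
     (\<forall>s w.
        C1_on D s \<and> C1_on D w \<and>
        linearized_irrotational_euler \<kappa> I r v s w \<and>
        (curl_free_on D w \<longrightarrow> (\<exists>\<psi>. C1_on D \<psi> \<and> potential_on D \<psi> w)) \<longrightarrow>
        (\<exists>\<psi>. C2_on I D \<psi> \<and> potential_on D \<psi> w \<and>
           (\<forall>(t, x)\<in>D.
              material_deriv I v \<psi> t x = - s t x \<and>
              material_deriv I v (material_deriv I v \<psi>) t x
                - grad (r t) x \<bullet> grad (\<psi> t) x - \<kappa> * r t x * laplacian (\<psi> t) x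
                = \<kappa> * s t x * dvg (v t) x)))"
proof -
  interpret spacetime_region I D
    using assms by unfold_locales
  have conn: "connected {x. (t, x) \<in> D}" if "t \<in> I" for t
    using assms(6) that by (simp add: D_def spacetime_domain_def)
  note r = assms(7) and v = assms(8)
  have mass: "material_deriv I v r t x = - \<kappa> * r t x * dvg (v t) x"
    and momentum: "material_deriv I v v t x = - grad (r t) x" if "(t, x) \<in> D" for t x
    using assms(9) that unfolding irrotational_euler_def D_def[symmetric]
    by (auto simp: eq_neg_iff_add_eq_0)
  have curl_v: "curl_free_on D v"
    using assms(9) by (simp add: irrotational_euler_def D_def)
  let ?e = "\<lambda>t x. v t x \<bullet> v t x"
  have e: "C1_on D ?e" by (rule C1_on_inner[OF v v])
  show ?thesis
  proof (intro conjI allI impI)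
    (* Bernoulli: the momentum equation reads dv/dt = - grad (|v|^2/2 + r). *)
    let ?g = "\<lambda>t x. (1/2) *\<^sub>R ?e t x + r t x"
    obtain \<phi>0 where \<phi>0: "C1_on D \<phi>0" "potential_on D \<phi>0 v"
      using assms(10) curl_v by blast
    have "time_deriv I v t x = - grad (?g t) x" if tx: "(t, x) \<in> D" for t x
    proof -
      have "time_deriv I v t x = material_deriv I v v t x - advect (v t x) (v t) x"
        by (simp add: material_deriv_def)
      then show ?thesis
        unfolding momentum[OF tx] grad_add_scaleR[OF e r tx]
          grad_inner_product[OF v v curl_v curl_v tx]
        by (simp flip: scaleR_2)
    qed
    then obtain \<phi> where \<phi>: "C2_on I D \<phi>" "potential_on D \<phi> v"
      and time_\<phi>: "\<And>t x. (t, x) \<in> D \<Longrightarrow> time_deriv I \<phi> t x = - ?g t x"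
      using potential_with_time_derivative[OF conn \<phi>0(1) v C1_on_add[OF C1_on_scaleR[OF e] r] \<phi>0(2)]
      by blast
    have C1: "C1_on D \<phi>" using \<phi>(1) by (simp add: C2_on_def)
    let ?m = "\<lambda>t x. (1/2) *\<^sub>R ?e t x + (-1) *\<^sub>R r t x"
    have first: "material_deriv I v \<phi> t x = ?m t x" if tx: "(t, x) \<in> D" for t x
      using material_deriv_potential[OF C1 \<phi>(2) tx, of v] time_\<phi>[OF tx] by simp
    have second: "material_deriv I v (material_deriv I v \<phi>) t x
             + grad (r t) x \<bullet> grad (\<phi> t) x - \<kappa> * r t x * laplacian (\<phi> t) x = 0"
      if tx: "(t, x) \<in> D" for t x
    proof -
      have "material_deriv I v (material_deriv I v \<phi>) t x = material_deriv I v ?m t x"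
        by (rule material_deriv_cong[OF C1_on_add[OF C1_on_scaleR[OF e] C1_on_scaleR[OF r]] first tx])
      also have "\<dots> = v t x \<bullet> material_deriv I v v t x - material_deriv I v r t x"
        by (simp only: material_deriv_add[OF C1_on_scaleR[OF e] C1_on_scaleR[OF r] tx]
            material_deriv_scaleR[OF e tx] material_deriv_scaleR[OF r tx] material_deriv_inner[OF v v tx])
           (simp add: inner_commute)
      finally show ?thesis
        using \<phi>(2) tx laplacian_potential[OF \<phi>(2) v tx]
        by (auto simp: mass[OF tx] momentum[OF tx] potential_on_def inner_commute)
    qed
    show "\<exists>\<phi>. C2_on I D \<phi> \<and> potential_on D \<phi> v \<and>
        (\<forall>(t, x)\<in>D.
           material_deriv I v \<phi> t x = (norm (v t x))\<^sup>2 / 2 - r t x \<and>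
           material_deriv I v (material_deriv I v \<phi>) t x
             + grad (r t) x \<bullet> grad (\<phi> t) x - \<kappa> * r t x * laplacian (\<phi> t) x = 0)"
      using \<phi> first second by (intro exI[of _ \<phi>]) (auto simp: power2_norm_eq_inner)
  next
    fix s w
    assume asm: "C1_on D s \<and> C1_on D w \<and> linearized_irrotational_euler \<kappa> I r v s w \<and>
      (curl_free_on D w \<longrightarrow> (\<exists>\<psi>. C1_on D \<psi> \<and> potential_on D \<psi> w))"
    then have s: "C1_on D s" and w: "C1_on D w" by auto
    have lin_mass: "material_deriv I v s t x = - (w t x \<bullet> grad (r t) x)
          - \<kappa> * s t x * dvg (v t) x - \<kappa> * r t x * dvg (w t) x"
      and lin_momentum: "material_deriv I v w t x = - advect (w t x) (v t) x - grad (s t) x"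
      if "(t, x) \<in> D" for t x
    proof -
      have *: "material_deriv I v s t x + w t x \<bullet> grad (r t) x
          + \<kappa> * s t x * dvg (v t) x + \<kappa> * r t x * dvg (w t) x = 0"
        "material_deriv I v w t x + advect (w t x) (v t) x + grad (s t) x = 0"
        using asm that unfolding linearized_irrotational_euler_def D_def[symmetric] by auto
      show "material_deriv I v s t x = - (w t x \<bullet> grad (r t) x)
          - \<kappa> * s t x * dvg (v t) x - \<kappa> * r t x * dvg (w t) x" using *(1) by linarith
      show "material_deriv I v w t x = - advect (w t x) (v t) x - grad (s t) x"
        using *(2) by (simp add: eq_neg_iff_add_eq_0 add.assoc algebra_simps)
    qed
    have curl_w: "curl_free_on D w"
      using asm by (simp add: linearized_irrotational_euler_def D_def)
    let ?h = "\<lambda>t x. v t x \<bullet> w t x"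
    (* Linearized Bernoulli: both advection terms together form grad (v . w), so
       dw/dt = - grad (v . w + s). The factor 1 matches the form in which the first part
       needs its factor 1/2. *)
    let ?g = "\<lambda>t x. 1 *\<^sub>R ?h t x + s t x"
    have h: "C1_on D ?h" by (rule C1_on_inner[OF v w])
    obtain \<psi>0 where \<psi>0: "C1_on D \<psi>0" "potential_on D \<psi>0 w"
      using asm curl_w by blast
    have "time_deriv I w t x = - grad (?g t) x" if tx: "(t, x) \<in> D" for t x
    proof -
      have "time_deriv I w t x = material_deriv I v w t x - advect (v t x) (w t) x"
        by (simp add: material_deriv_def)
      then show ?thesis
        unfolding lin_momentum[OF tx] grad_add_scaleR[OF h s tx]
          grad_inner_product[OF v w curl_v curl_w tx]
        by simp
    qed
    then obtain \<psi> where \<psi>: "C2_on I D \<psi>" "potential_on D \<psi> w"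
      and time_\<psi>: "\<And>t x. (t, x) \<in> D \<Longrightarrow> time_deriv I \<psi> t x = - ?g t x"
      using potential_with_time_derivative[OF conn \<psi>0(1) w C1_on_add[OF C1_on_scaleR[OF h] s] \<psi>0(2)]
      by blast
    have C1: "C1_on D \<psi>" using \<psi>(1) by (simp add: C2_on_def)
    have first: "material_deriv I v \<psi> t x = (-1) *\<^sub>R s t x" if tx: "(t, x) \<in> D" for t x
      using material_deriv_potential[OF C1 \<psi>(2) tx, of v] time_\<psi>[OF tx] by simp
    have second: "material_deriv I v (material_deriv I v \<psi>) t x
                - grad (r t) x \<bullet> grad (\<psi> t) x - \<kappa> * r t x * laplacian (\<psi> t) x
                = \<kappa> * s t x * dvg (v t) x"
      if tx: "(t, x) \<in> D" for t x
    proof -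
      have "material_deriv I v (material_deriv I v \<psi>) t x = - material_deriv I v s t x"
        using material_deriv_cong[OF C1_on_scaleR[OF s] first tx] material_deriv_scaleR[OF s tx, of v "-1"]
        by simp
      then show ?thesis
        using \<psi>(2) tx laplacian_potential[OF \<psi>(2) w tx]
        by (auto simp: lin_mass[OF tx] potential_on_def inner_commute)
    qed
    show "\<exists>\<psi>. C2_on I D \<psi> \<and> potential_on D \<psi> w \<and>
           (\<forall>(t, x)\<in>D.
              material_deriv I v \<psi> t x = - s t x \<and>
              material_deriv I v (material_deriv I v \<psi>) t x
                - grad (r t) x \<bullet> grad (\<psi> t) x - \<kappa> * r t x * laplacian (\<psi> t) x
                = \<kappa> * s t x * dvg (v t) x)"
      using \<psi> first second by (intro exI[of _ \<psi>]) auto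
  qed
qed

end
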